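(* Let $R=(r_{ij};i,j\in\mathbb{N})$ and $A=(a_{ij};i,j\in\mathbb{N})$ be stable and conservative $Q$-matrices on $\mathbb{N}$, and let $Q=R+A$. Let $Q(t)=\{Q_{ij}(t);i,j\in\mathbb{N}\}$ and $R(t)=\{R_{ij}(t);i,j\in\mathbb{N}\}$ be the Feller minimal transition functions of $Q$ and $R$, respectively, and write $a_k=-a_{kk}$. Then for all $i,j\in\mathbb{N}$ and $t\ge 0$, $$\sum_{k\in\mathbb{N}}\int_0^t R_{ik}(s)\,a_k\,Q_{kj}(t-s)\,ds=\sum_{l\in\mathbb{N},\,m\ne l}\int_0^t R_{il}(t-v)\,a_{lm}\,Q_{mj}(v)\,dv+R_{ij}(t)-Q_{ij}(t),$$ as an equality in $[0,\infty]$. In particular, when $\sum_{k\in\mathbb{N}}\int_0^t R_{ik}(s)a_kQ_{kj}(t-s)\,ds<\infty$, this can be rewritten as $$Q(t)-R(t)=\int_0^t R(s)\,A\,Q(t-s)\,ds,$$ that is, for the $(i,j)$ entry, $Q_{ij}(t)-R_{ij}(t)=\int_0^t\sum_{k,l\in\mathbb{N}}R_{ik}(s)\,a_{kl}\,Q_{lj}(t-s)\,ds$.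
   Context: $\mathbb{N}=\{0,1,2,\ldots\}$. A stable and conservative $Q$-matrix on $\mathbb{N}$ is a real matrix $(q_{ij};i,j\in\mathbb{N})$ with $q_{ij}\ge 0$ for $i\ne j$, $0\le -q_{ii}<\infty$ and $\sum_{j\in\mathbb{N}}q_{ij}=0$ for all $i$. The Feller minimal transition function $P(t)=\{P_{ij}(t);i,j\in\mathbb{N}\}$, $t\ge 0$, of a $Q$-matrix is the minimal nonnegative solution of its backward Kolmogorov equation $\frac{d}{dt}P_{ij}(t)=\sum_{k\in\mathbb{N}}q_{ik}P_{kj}(t)$ with $P_{ij}(0)=\delta_{ij}$. No boundedness of $A$ and no regularity of $R$ or $Q$ is assumed. The sum over $l\in\mathbb{N}$, $m\ne l$ is over all pairs $(l,m)\in\mathbb{N}^2$ with $m\neq l$. All terms of the two infinite sums in the first identity are nonnegative, so these sums are well defined in $[0,\infty]$. *)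

theory Defs
  imports "HOL-Analysis.Analysis"
begin

definition stable_conservative_Q_matrix :: "(nat \<Rightarrow> nat \<Rightarrow> real) \<Rightarrow> bool" where
  "stable_conservative_Q_matrix q \<longleftrightarrow>
     (\<forall>i j. i \<noteq> j \<longrightarrow> 0 \<le> q i j) \<and>
     (\<forall>i. 0 \<le> - q i i) \<and>
     (\<forall>i. (q i has_sum 0) UNIV)"

text \<open>
  A family is written \<open>P t i j\<close> for $P_{ij}(t)$; values at negative times are irrelevant.
  Since \<open>infsum\<close> is 0 on families that are not summable, convergence of the right-hand side
  of the backward equation is demanded separately. At time 0 the derivative is one-sided.
\<close>

definition nonneg_backward_solution ::
  "(nat \<Rightarrow> nat \<Rightarrow> real) \<Rightarrow> (real \<Rightarrow> nat \<Rightarrow> nat \<Rightarrow> real) \<Rightarrow> bool" where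
  "nonneg_backward_solution q P \<longleftrightarrow>
     (\<forall>i j. \<forall>t\<ge>0. 0 \<le> P t i j) \<and>
     (\<forall>i j. P 0 i j = (if i = j then 1 else 0)) \<and>
     (\<forall>i j. \<forall>t\<ge>0. (\<lambda>k. q i k * P t k j) summable_on UNIV \<and>
        ((\<lambda>s. P s i j) has_real_derivative (\<Sum>\<^sub>\<infinity>k. q i k * P t k j)) (at t within {0..}))"

definition feller_minimal_transition_function ::
  "(nat \<Rightarrow> nat \<Rightarrow> real) \<Rightarrow> (real \<Rightarrow> nat \<Rightarrow> nat \<Rightarrow> real) \<Rightarrow> bool" where
  "feller_minimal_transition_function q P \<longleftrightarrow>
     nonneg_backward_solution q P \<and>
     (\<forall>P'. nonneg_backward_solution q P' \<longrightarrow> (\<forall>i j. \<forall>t\<ge>0. P t i j \<le> P' t i j))"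

end

theory Submission
  imports Defs
begin

text \<open>
  All terms that occur are nonnegative once loss terms are moved to the other side, so the whole
  argument runs with values in \<open>[0, \<infinity>]\<close>, where convolutions, sums and monotone limits may be
  exchanged freely.

  For a \<open>Q\<close>-matrix \<open>q\<close> the minimal transition function is the increasing limit \<open>feller_lim q\<close> of the
  iteration that starts from \<open>0\<close> and applies the backward integral equation, with the holding
  time in the current state as integrating factor (\<open>feller_minimal_eq_lim\<close>). For a source \<open>\<phi>\<close>, the
  expression \<open>\<Sum>\<^sub>k \<integral> R\<^sub>i\<^sub>k(s) \<phi>\<^sub>k(t - s) ds\<close> is the limit of the same iteration with an
  inhomogeneous term (\<open>potential_iter_Suc\<close>, \<open>potential_lim\<close>).

  Fix \<open>j\<close> and let \<open>x\<close> be the \<open>j\<close>-th column of \<open>Q(t)\<close>. Variation of constants with the exit rates of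
  \<open>R\<close> alone (\<open>solution_renewal\<close>) says that \<open>x\<close> solves the inhomogeneous backward equation of \<open>R\<close>
  with source \<open>\<Sum>\<^sub>m a\<^sub>l\<^sub>m x\<^sub>m\<close> (\<open>m \<noteq> l\<close>), up to a loss term with rate \<open>a\<^sub>l\<close>. The minimal solution \<open>z\<close> of
  that equation without loss is \<open>R\<^sub>i\<^sub>j\<close> plus the first sum on the right of the theorem. The chain with
  loss does not exceed the chain without, so minimality of \<open>Q(t)\<close> yields \<open>x \<le> z\<close>. From this,
  induction along the iteration shows that \<open>x\<close> plus the potential of the lost mass is both at most
  and at least \<open>z\<close> (\<open>perturbation_identity\<close>).

  When the sum on the left is finite, so is the one on the right, and the integral over \<open>[0, t]\<close> of
  the signed double series is the difference of the two (\<open>signed_infsum\<close>).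
\<close>

section \<open>Convolution on the half-line\<close>

text \<open>
  Functions of time are extended to the whole line by zero at negative times, so that the integrals
  over \<open>[0, t]\<close> become convolutions over \<open>\<real>\<close>, and associativity follows from Tonelli and translation invariance without any bookkeeping of integration limits.
\<close>

definition conv :: "(real \<Rightarrow> ennreal) \<Rightarrow> (real \<Rightarrow> ennreal) \<Rightarrow> real \<Rightarrow> ennreal" where
  "conv f g t = (\<integral>\<^sup>+s. f s * g (t - s) \<partial>lborel)"

lemma conv_measurable [measurable]:
  assumes [measurable]: "f \<in> borel_measurable borel" "g \<in> borel_measurable borel"
  shows "conv f g \<in> borel_measurable borel"
  unfolding conv_def by measurable

lemma conv_commute:
  assumes [measurable]: "f \<in> borel_measurable borel" "g \<in> borel_measurable borel"
  shows "conv f g = conv g f"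
proof
  fix t
  have "conv f g t = (\<integral>\<^sup>+s. f (t + (-1) * s) * g (t - (t + (-1) * s)) \<partial>lborel)"
    unfolding conv_def by (subst nn_integral_real_affine[where c="-1" and t=t]) auto
  also have "\<dots> = conv g f t"
    unfolding conv_def by (simp add: mult.commute)
  finally show "conv f g t = conv g f t" .
qed

lemma conv_assoc:
  assumes [measurable]: "f \<in> borel_measurable borel" "g \<in> borel_measurable borel"
    "h \<in> borel_measurable borel"
  shows "conv (conv f g) h = conv f (conv g h)"
proof
  fix t
  have "conv (conv f g) h t = (\<integral>\<^sup>+s. (\<integral>\<^sup>+u. f u * g (s - u) * h (t - s) \<partial>lborel) \<partial>lborel)"
    unfolding conv_def by (simp add: nn_integral_multc)
  also have "\<dots> = (\<integral>\<^sup>+u. (\<integral>\<^sup>+s. f u * g (s - u) * h (t - s) \<partial>lborel) \<partial>lborel)"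
    by (rule lborel_pair.Fubini') measurable
  also have "\<dots> = (\<integral>\<^sup>+u. f u * (\<integral>\<^sup>+s. g (s - u) * h (t - s) \<partial>lborel) \<partial>lborel)"
    by (simp add: nn_integral_cmult mult.assoc)
  also have "\<dots> = conv f (conv g h) t"
    unfolding conv_def
  proof (rule nn_integral_cong)
    fix u
    have "(\<integral>\<^sup>+s. g (s - u) * h (t - s) \<partial>lborel) =
        (\<integral>\<^sup>+s. g (u + 1 * s - u) * h (t - (u + 1 * s)) \<partial>lborel)"
      by (subst nn_integral_real_affine[where c=1 and t=u]) auto
    then show "f u * (\<integral>\<^sup>+s. g (s - u) * h (t - s) \<partial>lborel) =
        f u * (\<integral>\<^sup>+s. g s * h (t - u - s) \<partial>lborel)"
      by (simp add: diff_diff_eq)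
  qed
  finally show "conv (conv f g) h t = conv f (conv g h) t" .
qed

lemma conv_mono: "(\<And>s. f s \<le> f' s) \<Longrightarrow> (\<And>s. g s \<le> g' s) \<Longrightarrow> conv f g t \<le> conv f' g' t"
  unfolding conv_def by (intro nn_integral_mono mult_mono) auto

lemma conv_add_right:
  assumes [measurable]: "f \<in> borel_measurable borel" "g \<in> borel_measurable borel"
    "h \<in> borel_measurable borel"
  shows "conv f (\<lambda>s. g s + h s) t = conv f g t + conv f h t"
  unfolding conv_def by (simp add: distrib_left nn_integral_add)

lemma conv_add_left:
  assumes [measurable]: "f \<in> borel_measurable borel" "g \<in> borel_measurable borel"
    "h \<in> borel_measurable borel"
  shows "conv (\<lambda>s. f s + g s) h t = conv f h t + conv g h t"
  unfolding conv_def by (simp add: distrib_right nn_integral_add)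

lemma conv_cmult_left:
  assumes [measurable]: "f \<in> borel_measurable borel" "g \<in> borel_measurable borel"
  shows "conv (\<lambda>s. c * f s) g t = c * conv f g t"
  unfolding conv_def by (simp add: mult.assoc nn_integral_cmult)

lemma conv_suminf_right:
  assumes [measurable]: "f \<in> borel_measurable borel" "\<And>n::nat. g n \<in> borel_measurable borel"
  shows "conv f (\<lambda>s. \<Sum>n. g n s) t = (\<Sum>n. conv f (g n) t)"
  unfolding conv_def by (simp add: nn_integral_suminf flip: ennreal_suminf_cmult)

lemma conv_suminf_left:
  assumes [measurable]: "\<And>n::nat. f n \<in> borel_measurable borel" "g \<in> borel_measurable borel"
  shows "conv (\<lambda>s. \<Sum>n. f n s) g t = (\<Sum>n. conv (f n) g t)"
  unfolding conv_def by (simp add: nn_integral_suminf flip: ennreal_suminf_multc)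

lemma conv_SUP_right:
  assumes [measurable]: "f \<in> borel_measurable borel" "\<And>n::nat. g n \<in> borel_measurable borel"
    and "incseq g"
  shows "conv f (\<lambda>s. SUP n. g n s) t = (SUP n. conv f (g n) t)"
  unfolding conv_def SUP_mult_left_ennreal
  by (rule nn_integral_monotone_convergence_SUP)
    (use \<open>incseq g\<close> in \<open>auto simp: incseq_def le_fun_def intro!: mult_left_mono\<close>)

lemma conv_SUP_left:
  assumes [measurable]: "\<And>n::nat. f n \<in> borel_measurable borel" "g \<in> borel_measurable borel"
    and "incseq f"
  shows "conv (\<lambda>s. SUP n. f n s) g t = (SUP n. conv (f n) g t)"
  unfolding conv_def SUP_mult_right_ennreal
  by (rule nn_integral_monotone_convergence_SUP)
    (use \<open>incseq f\<close> in \<open>auto simp: incseq_def le_fun_def intro!: mult_right_mono\<close>)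

lemma conv_zero_left [simp]: "conv (\<lambda>_. 0) f t = 0"
  by (simp add: conv_def)

lemma suminf_swap_ennreal:
  fixes f :: "nat \<Rightarrow> nat \<Rightarrow> ennreal"
  shows "(\<Sum>k. \<Sum>l. f k l) = (\<Sum>l. \<Sum>k. f k l)"
  using nn_integral_suminf[of "\<lambda>l k. f k l" "count_space UNIV"]
  by (simp add: nn_integral_count_space_nat)

section \<open>Iterating the backward renewal equation\<close>

text \<open>
  The probability that the chain has not left, by time \<open>t\<close>, a state with exit rate \<open>c\<close>.
\<close>

definition hold :: "real \<Rightarrow> real \<Rightarrow> ennreal" where
  "hold c t = ennreal (exp (- (c * t))) * indicator {0..} t"

text \<open>
  The gain term of the backward equation. With the loss term moved into \<open>hold\<close>, the backward
  equation of \<open>q\<close> reads \<open>y\<^sub>i = y\<^sub>i(0) hold + hold * jump q y i\<close>, in which every term is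
  nonnegative and \<open>*\<close> is convolution.
\<close>

definition jump :: "(nat \<Rightarrow> nat \<Rightarrow> real) \<Rightarrow> (nat \<Rightarrow> real \<Rightarrow> ennreal) \<Rightarrow> nat \<Rightarrow> real \<Rightarrow> ennreal" where
  "jump q y i s = (\<Sum>l. ennreal (if l = i then 0 else q i l) * y l s)"

lemma hold_measurable [measurable]: "hold c \<in> borel_measurable borel"
  unfolding hold_def by measurable

lemma jump_measurable [measurable]:
  assumes [measurable]: "\<And>l. y l \<in> borel_measurable borel"
  shows "jump q y i \<in> borel_measurable borel"
  unfolding jump_def by measurable

lemma jump_mono: "(\<And>l. y l s \<le> y' l s) \<Longrightarrow> jump q y i s \<le> jump q y' i s"
  unfolding jump_def by (intro suminf_le mult_left_mono) auto

lemma jump_add: "jump q (\<lambda>l s. y l s + y' l s) i s = jump q y i s + jump q y' i s"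
  unfolding jump_def by (simp add: distrib_left suminf_add)

lemma jump_SUP:
  assumes "\<And>l. incseq (\<lambda>n::nat. y n l s)"
  shows "jump q (\<lambda>l s. SUP n. y n l s) i s = (SUP n. jump q (y n) i s)"
  unfolding jump_def SUP_mult_left_ennreal
  by (rule ennreal_suminf_SUP_eq) (use assms in \<open>auto simp: incseq_def intro!: mult_left_mono\<close>)

lemma conv_jump:
  assumes [measurable]: "\<And>l. y l \<in> borel_measurable borel" "g \<in> borel_measurable borel"
  shows "conv (jump q y i) g t = jump q (\<lambda>l. conv (y l) g) i t"
  unfolding jump_def by (subst conv_suminf_left) (auto simp: conv_cmult_left)

lemma jump_suminf:
  "jump q (\<lambda>l s. \<Sum>k. y k l s) i s = (\<Sum>k. jump q (y k) i s)"
  unfolding jump_def by (simp add: suminf_swap_ennreal[of "\<lambda>k l. _ l * y k l s"]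
    flip: ennreal_suminf_cmult)

text \<open>
  \<open>feller_iter q k n i t\<close> is, for a \<open>Q\<close>-matrix \<open>q\<close>, the probability of going from \<open>i\<close> to \<open>k\<close> in time \<open>t\<close> with fewer
  than \<open>n\<close> jumps. The target \<open>k\<close> comes first because it stays fixed in the recursion.
\<close>

primrec feller_iter :: "(nat \<Rightarrow> nat \<Rightarrow> real) \<Rightarrow> nat \<Rightarrow> nat \<Rightarrow> nat \<Rightarrow> real \<Rightarrow> ennreal" where
  "feller_iter q k 0 = (\<lambda>i t. 0)"
| "feller_iter q k (Suc n) = (\<lambda>i t. (if i = k then hold (- q i i) t else 0)
     + conv (hold (- q i i)) (jump q (feller_iter q k n) i) t)"

definition feller_lim :: "(nat \<Rightarrow> nat \<Rightarrow> real) \<Rightarrow> nat \<Rightarrow> nat \<Rightarrow> real \<Rightarrow> ennreal" where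
  "feller_lim q k i t = (SUP n. feller_iter q k n i t)"

lemma feller_iter_measurable [measurable]: "feller_iter q k n i \<in> borel_measurable borel"
  by (induction n arbitrary: i) auto

lemma feller_lim_measurable [measurable]: "feller_lim q k i \<in> borel_measurable borel"
  unfolding feller_lim_def by measurable

lemma feller_iter_Suc_mono: "feller_iter q k n i t \<le> feller_iter q k (Suc n) i t"
proof (induction n arbitrary: i t)
  case (Suc n)
  show ?case
    unfolding feller_iter.simps(2)[of q k "Suc n"] 
    by (subst feller_iter.simps(2)) (intro add_left_mono conv_mono jump_mono Suc order_refl)
qed simp

lemma feller_iter_incseq: "incseq (\<lambda>n. feller_iter q k n i t)"
  by (rule incseq_SucI) (rule feller_iter_Suc_mono)

text \<open>
  Monotone convergence passes to the limit in any recursion of backward type, whatever its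
  inhomogeneous term \<open>g\<close>. Both \<open>feller_iter\<close> and the potentials below are of this kind.
\<close>

lemma renewal_SUP:
  assumes [measurable]: "\<And>n i. y n i \<in> borel_measurable borel"
    and inc: "\<And>i s. incseq (\<lambda>n. y n i s)"
    and step: "\<And>n i t. y (Suc n) i t = g i t + conv (hold (c i)) (jump q (y n) i) t"
  shows "(SUP n. y n i t) = g i t + conv (hold (c i)) (jump q (\<lambda>l s. SUP n. y n l s) i) t"
proof -
  have "(SUP n. y n i t) = (SUP n. y (Suc n) i t)"
    by (rule antisym) (auto intro!: SUP_mono incseq_SucD[OF inc] exI)
  also have "\<dots> = (SUP n. g i t + conv (hold (c i)) (jump q (y n) i) t)"
    by (simp add: step)
  also have "\<dots> = g i t + (SUP n. conv (hold (c i)) (jump q (y n) i) t)"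
    by (simp add: ennreal_SUP_add_right)
  also have "(SUP n. conv (hold (c i)) (jump q (y n) i) t) =
      conv (hold (c i)) (\<lambda>s. SUP n. jump q (y n) i s) t"
    using inc by (intro conv_SUP_right[symmetric])
      (auto simp: incseq_def le_fun_def intro!: jump_mono)
  also have "(\<lambda>s. SUP n. jump q (y n) i s) = jump q (\<lambda>l s. SUP n. y n l s) i"
    using jump_SUP[OF inc] by (simp add: fun_eq_iff)
  finally show ?thesis .
qed

lemma feller_lim_renewal:
  "feller_lim q k i t = (if i = k then hold (- q i i) t else 0)
     + conv (hold (- q i i)) (jump q (feller_lim q k) i) t"
  unfolding feller_lim_def[abs_def]
  by (rule renewal_SUP[where c="\<lambda>i. - q i i" and g="\<lambda>i t. if i = k then hold (- q i i) t else 0"])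
    (auto intro: feller_iter_incseq)

text \<open>
  For \<open>F = feller_lim q\<close> this is the expected integral of \<open>\<phi> k (t - s)\<close> along the path of the
  minimal chain started in \<open>i\<close>, where \<open>k\<close> is its position at time \<open>s\<close>. Both sums of the theorem
  are of this form.
\<close>

definition potential ::
  "(nat \<Rightarrow> nat \<Rightarrow> real \<Rightarrow> ennreal) \<Rightarrow> (nat \<Rightarrow> real \<Rightarrow> ennreal) \<Rightarrow> nat \<Rightarrow> real \<Rightarrow> ennreal" where
  "potential F \<phi> i t = (\<Sum>k. conv (F k i) (\<phi> k) t)"

lemma potential_measurable [measurable]:
  assumes [measurable]: "\<And>k i. F k i \<in> borel_measurable borel" "\<And>k. \<phi> k \<in> borel_measurable borel"
  shows "potential F \<phi> i \<in> borel_measurable borel"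
  unfolding potential_def by measurable

text \<open>
  Convolving each column of the backward recursion with \<open>\<phi> k\<close> and summing over \<open>k\<close> gives the
  same recursion with \<open>hold * \<phi> i\<close> as the inhomogeneous term; this is associativity of the
  convolution together with two exchanges of sums.
\<close>

lemma potential_iter_Suc:
  assumes [measurable]: "\<And>k. \<phi> k \<in> borel_measurable borel"
  shows "potential (\<lambda>k. feller_iter q k (Suc n)) \<phi> i t =
    conv (hold (- q i i)) (\<phi> i) t
    + conv (hold (- q i i)) (jump q (potential (\<lambda>k. feller_iter q k n) \<phi>) i) t"
proof -
  let ?h = "hold (- q i i)"
  let ?J = "\<lambda>k. jump q (feller_iter q k n) i"
  have "conv (feller_iter q k (Suc n) i) (\<phi> k) t =
      (if k = i then conv ?h (\<phi> i) t else 0) + conv ?h (conv (?J k) (\<phi> k)) t" for k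
  proof -
    have "conv (feller_iter q k (Suc n) i) (\<phi> k) t =
       conv (\<lambda>t. if i = k then ?h t else 0) (\<phi> k) t + conv (conv ?h (?J k)) (\<phi> k) t"
      unfolding feller_iter.simps(2) by (rule conv_add_left) measurable
    then show ?thesis by (auto simp: conv_assoc)
  qed
  then have "potential (\<lambda>k. feller_iter q k (Suc n)) \<phi> i t =
      (\<Sum>k. (if k = i then conv ?h (\<phi> i) t else 0)) + (\<Sum>k. conv ?h (conv (?J k) (\<phi> k)) t)"
    unfolding potential_def by (simp add: suminf_add del: feller_iter.simps)
  also have "(\<Sum>k. (if k = i then conv ?h (\<phi> i) t else 0)) = conv ?h (\<phi> i) t"
    by (subst suminf_finite[of "{i}"]) auto
  also have "(\<Sum>k. conv ?h (conv (?J k) (\<phi> k)) t) = conv ?h (\<lambda>s. \<Sum>k. conv (?J k) (\<phi> k) s) t"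
    by (rule conv_suminf_right[symmetric]) measurable
  also have "(\<lambda>s. \<Sum>k. conv (?J k) (\<phi> k) s) = jump q (potential (\<lambda>k. feller_iter q k n) \<phi>) i"
    unfolding potential_def[abs_def] by (simp add: conv_jump jump_suminf fun_eq_iff)
  finally show ?thesis .
qed

lemma potential_iter_incseq: "incseq (\<lambda>n. potential (\<lambda>k. feller_iter q k n) \<phi> i t)"
  unfolding potential_def
  by (intro incseq_SucI suminf_le conv_mono feller_iter_Suc_mono) auto

lemma potential_lim:
  assumes [measurable]: "\<And>k. \<phi> k \<in> borel_measurable borel"
  shows "potential (feller_lim q) \<phi> i t = (SUP n. potential (\<lambda>k. feller_iter q k n) \<phi> i t)"
proof -
  have "conv (feller_lim q k i) (\<phi> k) t = (SUP n. conv (feller_iter q k n i) (\<phi> k) t)" for k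
    unfolding feller_lim_def[abs_def]
    by (rule conv_SUP_left) (auto simp: incseq_def le_fun_def intro: incseqD[OF feller_iter_incseq])
  moreover have "incseq (\<lambda>n. conv (feller_iter q k n i) (\<phi> k) t)" for k
    by (intro incseq_SucI conv_mono feller_iter_Suc_mono) auto
  ultimately show ?thesis
    unfolding potential_def by (simp add: ennreal_suminf_SUP_eq)
qed

lemma potential_lim_renewal:
  assumes [measurable]: "\<And>k. \<phi> k \<in> borel_measurable borel"
  shows "potential (feller_lim q) \<phi> i t = conv (hold (- q i i)) (\<phi> i) t
     + conv (hold (- q i i)) (jump q (potential (feller_lim q) \<phi>) i) t"
proof -
  have "(SUP n. potential (\<lambda>k. feller_iter q k n) \<phi> i t) = conv (hold (- q i i)) (\<phi> i) t
     + conv (hold (- q i i)) (jump q (\<lambda>l s. SUP n. potential (\<lambda>k. feller_iter q k n) \<phi> l s) i) t"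
    by (rule renewal_SUP[where c="\<lambda>i. - q i i" and g="\<lambda>i. conv (hold (- q i i)) (\<phi> i)"])
      (auto intro: potential_iter_incseq simp: potential_iter_Suc simp del: feller_iter.simps)
  moreover have "(\<lambda>l s. SUP n. potential (\<lambda>k. feller_iter q k n) \<phi> l s) = potential (feller_lim q) \<phi>"
    by (simp add: potential_lim fun_eq_iff)
  ultimately show ?thesis by (simp only: potential_lim[OF assms])
qed

section \<open>Solutions of the backward equation\<close>

lemma has_sum_off_diagonal:
  fixes q :: "nat \<Rightarrow> nat \<Rightarrow> real"
  assumes "((\<lambda>k. q i k * p k) has_sum D) UNIV"
  shows "((\<lambda>k. (if k = i then 0 else q i k) * p k) has_sum (D - q i i * p i)) UNIV"
proof -
  have "((\<lambda>k. q i k * p k + (if k = i then - q i i * p i else 0)) has_sum (D + - q i i * p i)) UNIV"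
    by (intro has_sum_add assms has_sum_finite_neutralI[of "{i}"]) auto
  also have "(\<lambda>k. q i k * p k + (if k = i then - q i i * p i else 0)) =
      (\<lambda>k. (if k = i then 0 else q i k) * p k)"
    by auto
  finally show ?thesis by simp
qed

lemma suminf_ennreal_has_sum:
  fixes f :: "nat \<Rightarrow> real"
  assumes "(f has_sum D) UNIV" "\<And>n. 0 \<le> f n"
  shows "(\<Sum>n. ennreal (f n)) = ennreal D"
proof -
  have "f sums D" by (rule has_sum_imp_sums[OF assms(1)])
  then have "summable f" and D: "suminf f = D" by (simp_all add: sums_iff)
  then have "(\<Sum>n. ennreal (f n)) = ennreal (suminf f)"
    by (intro suminf_ennreal2 assms(2))
  then show ?thesis unfolding D .
qed

lemma exit_rate_has_sum:
  assumes "stable_conservative_Q_matrix q"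
  shows "((\<lambda>k. if k = i then 0 else q i k) has_sum (- q i i)) UNIV"
  using has_sum_off_diagonal[of q i "\<lambda>_. 1" 0] assms
  by (simp add: stable_conservative_Q_matrix_def)

text \<open>
  The form in which variation of constants produces these integrals: the factor
  \<open>exp (- c (t - s))\<close> is split so that the integrating factor \<open>exp (c s)\<close> remains inside.
\<close>

lemma conv_hold:
  assumes [measurable]: "g \<in> borel_measurable borel"
    and neg: "\<And>s. s < 0 \<Longrightarrow> g s = 0"
    and g: "\<And>s. 0 \<le> s \<Longrightarrow> s \<le> t \<Longrightarrow> g s = ennreal (h s)"
  shows "conv (hold c) g t =
    ennreal (exp (- (c * t))) * (\<integral>\<^sup>+s\<in>{0..t}. ennreal (exp (c * s) * h s) \<partial>lborel)"
proof -
  have "conv (hold c) g t = conv g (hold c) t"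
    by (subst conv_commute) auto
  also have "\<dots> = (\<integral>\<^sup>+s. ennreal (exp (- (c * t))) *
      (ennreal (exp (c * s)) * g s * indicator {0..t} s) \<partial>lborel)"
    unfolding conv_def
  proof (rule nn_integral_cong)
    fix s
    have "ennreal (exp (- (c * (t - s)))) = ennreal (exp (- (c * t))) * ennreal (exp (c * s))"
      by (simp flip: ennreal_mult exp_add add: algebra_simps)
    then show "g s * hold c (t - s) =
        ennreal (exp (- (c * t))) * (ennreal (exp (c * s)) * g s * indicator {0..t} s)"
      using neg[of s] by (auto simp: hold_def mult_ac split: split_indicator)
  qed
  also have "\<dots> = ennreal (exp (- (c * t))) *
      (\<integral>\<^sup>+s. ennreal (exp (c * s)) * g s * indicator {0..t} s \<partial>lborel)"
    by (rule nn_integral_cmult) auto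
  also have "(\<integral>\<^sup>+s. ennreal (exp (c * s)) * g s * indicator {0..t} s \<partial>lborel) =
      (\<integral>\<^sup>+s\<in>{0..t}. ennreal (exp (c * s) * h s) \<partial>lborel)"
    by (rule nn_integral_cong) (auto simp: g ennreal_mult' split: split_indicator)
  finally show ?thesis .
qed

lemma conv_hold_has_integral:
  assumes "g \<in> borel_measurable borel"
    and "\<And>s. s < 0 \<Longrightarrow> g s = 0"
    and "\<And>s. 0 \<le> s \<Longrightarrow> s \<le> t \<Longrightarrow> g s = ennreal (h s)"
    and h: "\<And>s. 0 \<le> s \<Longrightarrow> s \<le> t \<Longrightarrow> 0 \<le> h s"
    and I: "((\<lambda>s. exp (c * s) * h s) has_integral I) {0..t}"
  shows "conv (hold c) g t = ennreal (exp (- (c * t)) * I)"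
proof -
  have "(\<integral>\<^sup>+s\<in>{0..t}. ennreal (exp (c * s) * h s) \<partial>lborel) = ennreal I"
    by (rule nn_integral_has_integral_lebesgue'[OF _ I]) (use h in auto)
  then show ?thesis
    using conv_hold[OF assms(1-3)] by (simp add: ennreal_mult')
qed

lemma conv_hold_neg:
  assumes "t < 0" "\<And>s. s < 0 \<Longrightarrow> g s = 0"
  shows "conv (hold c) g t = 0"
proof -
  have "hold c s * g (t - s) = 0" for s
    using assms(2)[of "t - s"] assms(1) by (cases "0 \<le> s") (auto simp: hold_def)
  then show ?thesis unfolding conv_def by (simp only: nn_integral_const mult_zero_left)
qed

text \<open>
  The \<open>j\<close>-th column of \<open>P\<close>, cut off at negative times. The order of the indices is that of
  \<open>feller_lim\<close>.
\<close>

definition at_nonneg :: "(real \<Rightarrow> nat \<Rightarrow> nat \<Rightarrow> real) \<Rightarrow> nat \<Rightarrow> nat \<Rightarrow> real \<Rightarrow> ennreal" where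
  "at_nonneg P j i s = ennreal (P s i j) * indicator {0..} s"

lemma solution_continuous:
  assumes "nonneg_backward_solution q P"
  shows "continuous_on {0..} (\<lambda>s. P s i j)"
  using assms unfolding nonneg_backward_solution_def continuous_on_eq_continuous_within
  by (meson DERIV_continuous atLeast_iff)

lemma solution_measurable:
  assumes "nonneg_backward_solution q P"
  shows "at_nonneg P j i \<in> borel_measurable borel"
proof -
  have "(\<lambda>s. P s i j * indicator {0..} s) \<in> borel_measurable borel"
    using borel_measurable_continuous_on_indicator[OF _ solution_continuous[OF assms]]
    by (simp add: mult.commute)
  then have "(\<lambda>s. ennreal (P s i j * indicator {0..} s)) \<in> borel_measurable borel"
    by measurable
  also have "(\<lambda>s. ennreal (P s i j * indicator {0..} s)) = at_nonneg P j i"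
    by (auto simp: at_nonneg_def fun_eq_iff split: split_indicator)
  finally show ?thesis .
qed

lemma jump_neg: "s < 0 \<Longrightarrow> (\<And>l. y l s = 0) \<Longrightarrow> jump q y i s = 0"
  by (simp add: jump_def)

text \<open>
  Variation of constants, where only the part \<open>c\<close> of the exit rate \<open>c + a\<close> goes into the
  integrating factor; the loss term with rate \<open>a\<close> is put on the left so that all terms remain
  nonnegative. With \<open>a = 0\<close> this is the usual backward integral equation. For \<open>q = R + A\<close>, with
  \<open>c\<close> and \<open>a\<close> the exit rates of \<open>R\<close> and \<open>A\<close>, it compares \<open>Q\<close> with the holding times of \<open>R\<close>.
\<close>

lemma solution_renewal:
  assumes q: "stable_conservative_Q_matrix q"
    and P: "nonneg_backward_solution q P"
    and c: "c + a = - q i i" and "0 \<le> a"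
  shows "at_nonneg P j i t + conv (hold c) (\<lambda>s. ennreal a * at_nonneg P j i s) t =
    (if i = j then hold c t else 0) + conv (hold c) (jump q (at_nonneg P j) i) t"
proof (cases "0 \<le> t")
  case False
  then show ?thesis
    by (simp add: conv_hold_neg jump_neg at_nonneg_def hold_def)
next
  case t: True
  have [measurable]: "at_nonneg P j l \<in> borel_measurable borel" for l
    by (rule solution_measurable[OF P])
  have P_nonneg: "0 \<le> P s l j" if "0 \<le> s" for s l
    using P that by (auto simp: nonneg_backward_solution_def)
  define N where "N s = (\<Sum>\<^sub>\<infinity>k. q i k * P s k j) - q i i * P s i j" for s
  have N_sum: "((\<lambda>k. (if k = i then 0 else q i k) * P s k j) has_sum N s) UNIV" if "0 \<le> s" for s
    unfolding N_def using P that
    by (intro has_sum_off_diagonal) (auto simp: nonneg_backward_solution_def)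
  have off_nonneg: "0 \<le> (if k = i then 0 else q i k)" for k
    using q by (auto simp: stable_conservative_Q_matrix_def)
  have N_nonneg: "0 \<le> N s" if "0 \<le> s" for s
    by (rule has_sum_nonneg[OF N_sum[OF that]])
      (intro mult_nonneg_nonneg off_nonneg P_nonneg that)
  have jump_N: "jump q (at_nonneg P j) i s = ennreal (N s)" if "0 \<le> s" for s
  proof -
    have "jump q (at_nonneg P j) i s = (\<Sum>k. ennreal ((if k = i then 0 else q i k) * P s k j))"
      unfolding jump_def using that P_nonneg[OF that] off_nonneg
      by (simp add: at_nonneg_def ennreal_mult)
    also have "\<dots> = ennreal (N s)"
      by (intro suminf_ennreal_has_sum N_sum that mult_nonneg_nonneg off_nonneg P_nonneg)
    finally show ?thesis .
  qed
  let ?u = "\<lambda>s. exp (c * s) * P s i j"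
  have deriv: "(?u has_real_derivative (exp (c * s) * N s - exp (c * s) * (a * P s i j)))
      (at s within {0..t})" if "s \<in> {0..t}" for s
  proof -
    have "((\<lambda>s. P s i j) has_real_derivative (N s + q i i * P s i j)) (at s within {0..})"
      using P that by (auto simp: nonneg_backward_solution_def N_def)
    then have "((\<lambda>s. P s i j) has_real_derivative (N s + q i i * P s i j)) (at s within {0..t})"
      by (rule DERIV_subset) auto
    then have "(?u has_real_derivative
        (exp (c * s) * c * P s i j + exp (c * s) * (N s + q i i * P s i j))) (at s within {0..t})"
      by (auto intro!: derivative_eq_intros)
    moreover have "q i i = - c - a" using c by simp
    ultimately show ?thesis
      by (simp add: algebra_simps)
  qed
  have u_int: "((\<lambda>s. exp (c * s) * N s - exp (c * s) * (a * P s i j)) has_integral ?u t - ?u 0) {0..t}"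
    using deriv t by (intro fundamental_theorem_of_calculus)
      (auto simp: has_real_derivative_iff_has_vector_derivative)
  have "(\<lambda>s. exp (c * s) * (a * P s i j)) integrable_on {0..t}"
    by (intro integrable_continuous_real continuous_intros
        continuous_on_subset[OF solution_continuous[OF P]]) auto
  then obtain I where I: "((\<lambda>s. exp (c * s) * (a * P s i j)) has_integral I) {0..t}"
    by (auto simp: integrable_on_def)
  have N_int: "((\<lambda>s. exp (c * s) * N s) has_integral (?u t - ?u 0 + I)) {0..t}"
    using has_integral_add[OF u_int I] by simp
  have I_nonneg: "0 \<le> I"
    by (rule has_integral_nonneg[OF I]) (use \<open>0 \<le> a\<close> P_nonneg in auto)
  let ?e = "exp (- (c * t))"
  have conv_a: "conv (hold c) (\<lambda>s. ennreal a * at_nonneg P j i s) t = ennreal (?e * I)"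
  proof (rule conv_hold_has_integral[OF _ _ _ _ I])
    show "ennreal a * at_nonneg P j i s = ennreal (a * P s i j)" if "0 \<le> s" for s
      using that \<open>0 \<le> a\<close> P_nonneg[OF that] by (simp add: at_nonneg_def ennreal_mult)
    show "0 \<le> a * P s i j" if "0 \<le> s" for s
      using \<open>0 \<le> a\<close> P_nonneg[OF that] by simp
  qed (measurable, simp add: at_nonneg_def)
  have conv_N: "conv (hold c) (jump q (at_nonneg P j) i) t = ennreal (?e * (?u t - ?u 0 + I))"
  proof (rule conv_hold_has_integral[OF _ _ _ _ N_int])
    show "jump q (at_nonneg P j) i s = 0" if "s < 0" for s
      using that by (intro jump_neg) (simp_all add: at_nonneg_def)
  qed (measurable, simp_all only: jump_N N_nonneg)
  have real_eq: "P t i j + ?e * I = (if i = j then ?e else 0) + ?e * (?u t - ?u 0 + I)"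
  proof -
    have "P 0 i j = (if i = j then 1 else 0)"
      using P by (auto simp: nonneg_backward_solution_def)
    then have "(if i = j then ?e else 0) + ?e * (?u t - ?u 0 + I) = ?e * ?u t + ?e * I"
      by (simp add: distrib_left right_diff_distrib)
    moreover have "?e * ?u t = P t i j"
      by (simp flip: mult.assoc exp_add)
    ultimately show ?thesis by simp
  qed
  have nonneg: "0 \<le> ?e * (?u t - ?u 0 + I)"
    using has_integral_nonneg[OF N_int] N_nonneg by simp
  have "at_nonneg P j i t + conv (hold c) (\<lambda>s. ennreal a * at_nonneg P j i s) t =
      ennreal (P t i j + ?e * I)"
    unfolding conv_a using t I_nonneg P_nonneg[OF t] by (simp add: at_nonneg_def ennreal_plus)
  also have "\<dots> = ennreal (if i = j then ?e else 0) + ennreal (?e * (?u t - ?u 0 + I))"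
    unfolding real_eq using nonneg by (intro ennreal_plus) auto
  also have "ennreal (if i = j then ?e else 0) = (if i = j then hold c t else 0)"
    using t by (simp add: hold_def)
  finally show ?thesis by (simp only: conv_N)
qed

lemma feller_iter_le_solution:
  assumes q: "stable_conservative_Q_matrix q" and P: "nonneg_backward_solution q P"
  shows "feller_iter q j n i t \<le> at_nonneg P j i t"
proof (induction n arbitrary: i t)
  case (Suc n)
  have "feller_iter q j (Suc n) i t \<le> (if i = j then hold (- q i i) t else 0)
      + conv (hold (- q i i)) (jump q (at_nonneg P j) i) t"
    unfolding feller_iter.simps by (intro add_left_mono conv_mono jump_mono Suc order_refl)
  also have "\<dots> = at_nonneg P j i t"
    using solution_renewal[OF q P, of "- q i i" 0 i j t] by (simp add: conv_def)
  finally show ?case .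
qed simp

lemma jump_unit:
  assumes "stable_conservative_Q_matrix q"
  shows "jump q (\<lambda>_. indicator {0..}) i s = ennreal (- q i i) * indicator {0..} s"
proof -
  have "(\<Sum>l. ennreal (if l = i then 0 else q i l)) = ennreal (- q i i)"
    by (rule suminf_ennreal_has_sum[OF exit_rate_has_sum[OF assms]])
      (use assms in \<open>auto simp: stable_conservative_Q_matrix_def\<close>)
  then show ?thesis by (simp add: jump_def)
qed

text \<open>
  The constant \<open>1\<close> satisfies \<open>1 \<ge> \<delta> hold + hold * jump q 1\<close>, because \<open>q\<close> is conservative, so the
  iteration stays below it.
\<close>

lemma feller_iter_le_one:
  assumes q: "stable_conservative_Q_matrix q"
  shows "feller_iter q j n i t \<le> indicator {0..} t"
proof (induction n arbitrary: i t)
  case (Suc n)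
  let ?c = "- q i i"
  have c: "0 \<le> ?c" using q by (simp add: stable_conservative_Q_matrix_def)
  have "feller_iter q j (Suc n) i t \<le> hold ?c t
      + conv (hold ?c) (jump q (\<lambda>_. indicator {0..}) i) t"
    unfolding feller_iter.simps by (intro add_mono conv_mono jump_mono Suc order_refl) auto
  also have "\<dots> = indicator {0..} t"
  proof (cases "0 \<le> t")
    case True
    have "((\<lambda>s. exp (?c * s) * ?c) has_integral (exp (?c * t) - exp (?c * 0))) {0..t}"
      using True by (intro fundamental_theorem_of_calculus)
        (auto intro!: derivative_eq_intros simp flip: has_real_derivative_iff_has_vector_derivative)
    then have "conv (hold ?c) (jump q (\<lambda>_. indicator {0..}) i) t =
        ennreal (exp (- (?c * t)) * (exp (?c * t) - exp (?c * 0)))"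
      using c by (intro conv_hold_has_integral[where h="\<lambda>_. ?c"]) (auto simp: jump_unit[OF q])
    also have "exp (- (?c * t)) * (exp (?c * t) - exp (?c * 0)) = 1 - exp (- (?c * t))"
      by (simp add: right_diff_distrib flip: exp_add)
    finally have "conv (hold ?c) (jump q (\<lambda>_. indicator {0..}) i) t =
        ennreal (1 - exp (- (?c * t)))" .
    moreover have "hold ?c t = ennreal (exp (- (?c * t)))"
      using True by (simp add: hold_def)
    moreover have "0 \<le> ?c * t"
      using True c by (rule mult_nonneg_nonneg[rotated])
    ultimately show ?thesis
      using True by (simp add: mult_nonpos_nonneg flip: ennreal_plus)
  qed (simp add: hold_def conv_hold_neg jump_unit[OF q])
  finally show ?case .
qed simp

text \<open>
  The renewal equation has to be differentiated at every point. This is done by bootstrapping: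
  a bounded solution is an indefinite integral and hence continuous; the gain term is then a
  series of continuous functions dominated by the summable rates, so it is continuous too; and
  then the fundamental theorem of calculus applies.
\<close>

lemma feller_lim_is_solution:
  assumes q: "stable_conservative_Q_matrix q"
  shows "nonneg_backward_solution q (\<lambda>s i j. enn2real (feller_lim q j i s))"
proof -
  let ?P = "\<lambda>s i j. enn2real (feller_lim q j i s)"
  have le_one: "feller_lim q j i s \<le> indicator {0..} s" for i j s
    unfolding feller_lim_def by (intro SUP_least feller_iter_le_one q)
  have fin: "feller_lim q j i s = ennreal (?P s i j)" for i j s
  proof -
    have "feller_lim q j i s < top"
      by (rule le_less_trans[OF le_one]) (simp split: split_indicator)
    then show ?thesis by simp
  qed
  have P_le_one: "?P s i j \<le> 1" for i j s
  proof -
    have "ennreal (?P s i j) \<le> indicator {0..} s"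
      unfolding fin[symmetric] by (rule le_one)
    also have "\<dots> \<le> ennreal 1" by (simp split: split_indicator)
    finally show ?thesis by (simp del: ennreal_1)
  qed
  have lim_neg: "feller_lim q j i s = 0" if "s < 0" for i j s
    using le_one[of j i s] that by simp
  define off where "off i k = (if k = i then 0 else q i k)" for i k
  have off_nonneg: "0 \<le> off i k" for i k
    using q by (auto simp: stable_conservative_Q_matrix_def off_def)
  have off_sum: "(off i has_sum (- q i i)) UNIV" for i
    using exit_rate_has_sum[OF q, of i] by (simp add: off_def[abs_def])
  define N where "N i j s = (\<Sum>k. off i k * ?P s k j)" for i j s
  have sum_off: "summable (off i)" for i
    using has_sum_imp_sums[OF off_sum] by (simp add: sums_iff)
  have sum_N: "summable (\<lambda>k. off i k * ?P s k j)" for i j s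
    by (rule summable_comparison_test'[OF sum_off[of i], of 0])
      (auto simp: abs_mult off_nonneg P_le_one mult_left_le)
  have N_nonneg: "0 \<le> N i j s" for i j s
    unfolding N_def by (intro suminf_nonneg sum_N) (simp add: off_nonneg)
  have jump_N: "jump q (feller_lim q j) i s = ennreal (N i j s)" for i j s
  proof -
    have "jump q (feller_lim q j) i s = (\<Sum>k. ennreal (off i k * ?P s k j))"
      unfolding jump_def by (subst fin) (simp add: off_nonneg ennreal_mult flip: off_def)
    then show ?thesis
      unfolding N_def by (simp add: suminf_ennreal2 off_nonneg sum_N)
  qed
  have N_int: "(\<lambda>s. exp (- q i i * s) * N i j s) integrable_on {0..t}"
    and P_eq: "?P t i j = exp (- (- q i i * t)) *
        ((if i = j then 1 else 0) + integral {0..t} (\<lambda>s. exp (- q i i * s) * N i j s))"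
    if t: "0 \<le> t" for i j t
  proof -
    let ?f = "\<lambda>s. exp (- q i i * s) * N i j s"
    have N_meas [measurable]: "(\<lambda>s. N i j s) \<in> borel_measurable borel"
      unfolding N_def by measurable
    let ?C = "conv (hold (- q i i)) (jump q (feller_lim q j) i) t"
    have C: "?C = ennreal (exp (- (- q i i * t))) * (\<integral>\<^sup>+s\<in>{0..t}. ennreal (?f s) \<partial>lborel)"
      by (rule conv_hold) (auto simp: jump_N[symmetric] jump_neg lim_neg)
    have "?C \<le> feller_lim q j i t"
      by (subst feller_lim_renewal) auto
    also have "\<dots> < \<infinity>" by (subst fin) simp
    finally have "(\<integral>\<^sup>+s\<in>{0..t}. ennreal (?f s) \<partial>lborel) < \<infinity>"
      unfolding C by (auto simp: ennreal_mult_less_top)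
    moreover have eq: "(\<integral>\<^sup>+s\<in>{0..t}. ennreal (?f s) \<partial>lborel) =
        (\<integral>\<^sup>+s. ennreal (indicator {0..t} s * ?f s) \<partial>lborel)"
      by (intro nn_integral_cong) (auto split: split_indicator)
    ultimately have "(\<lambda>s. indicator {0..t} s * ?f s) integrable_on UNIV"
      by (intro nn_integral_integrable_on) (auto simp: N_nonneg)
    then have "(\<lambda>s. if s \<in> {0..t} then ?f s else 0) integrable_on UNIV"
      by (rule integrable_eq) auto
    then show int: "?f integrable_on {0..t}"
      by (simp only: integrable_restrict_UNIV)
    have I_nonneg: "0 \<le> integral {0..t} ?f"
      by (intro integral_nonneg int) (simp add: N_nonneg)
    have "(\<integral>\<^sup>+s\<in>{0..t}. ennreal (?f s) \<partial>lborel) = ennreal (integral {0..t} ?f)"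
      by (rule nn_integral_has_integral_lebesgue'[OF _ integrable_integral[OF int]])
        (simp add: N_nonneg)
    then have C_eq: "?C = ennreal (exp (- (- q i i * t)) * integral {0..t} ?f)"
      unfolding C by (simp add: ennreal_mult')
    then have "ennreal (?P t i j) = ennreal (exp (- (- q i i * t)) *
        ((if i = j then 1 else 0) + integral {0..t} ?f))"
    proof -
      have "ennreal (?P t i j) = (if i = j then hold (- q i i) t else 0) + ?C"
        by (subst fin[symmetric]) (rule feller_lim_renewal)
      also have "(if i = j then hold (- q i i) t else 0) =
          ennreal (exp (- (- q i i * t)) * (if i = j then 1 else 0))"
        using t by (simp add: hold_def)
      finally show ?thesis
        unfolding C_eq distrib_left using I_nonneg by (simp only: ennreal_plus mult_nonneg_nonneg
          exp_ge_zero zero_le_one order_refl simp_thms split: if_split)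
    qed
    then show "?P t i j = exp (- (- q i i * t)) *
        ((if i = j then 1 else 0) + integral {0..t} ?f)"
      using I_nonneg by (subst (asm) ennreal_inj) auto
  qed
  have P_cont: "continuous_on {0..T} (\<lambda>s. ?P s i j)" for i j T
  proof -
    have "continuous_on {0..T} (\<lambda>t. exp (- (- q i i * t)) *
        ((if i = j then 1 else 0) + integral {0..t} (\<lambda>s. exp (- q i i * s) * N i j s)))"
      by (cases "0 \<le> T")
        (use N_int[of T i j] in \<open>auto intro!: continuous_intros indefinite_integral_continuous_1\<close>)
    also have "?this \<longleftrightarrow> ?thesis"
      by (intro continuous_on_cong refl P_eq[symmetric]) simp
    finally show ?thesis .
  qed
  have N_cont: "continuous_on {0..T} (N i j)" for i j T
  proof (rule uniform_limit_theorem[where F=sequentially])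
    show "\<forall>\<^sub>F n in sequentially. continuous_on {0..T} (\<lambda>s. \<Sum>k<n. off i k * ?P s k j)"
      by (intro always_eventually allI continuous_intros P_cont)
    show "uniform_limit {0..T} (\<lambda>n s. \<Sum>k<n. off i k * ?P s k j) (N i j) sequentially"
      unfolding N_def
      by (rule Weierstrass_m_test[OF _ sum_off[of i]])
        (auto simp: abs_mult off_nonneg P_le_one mult_left_le)
  qed auto
  have N_has_sum: "((\<lambda>k. off i k * ?P s k j) has_sum N i j s) UNIV" for i j s
    unfolding N_def using sum_N[of i j s]
    by (intro sums_nonneg_imp_has_sum) (auto simp: off_nonneg)
  have sum_eq: "((\<lambda>k. q i k * ?P s k j) has_sum (N i j s + q i i * ?P s i j)) UNIV" for i j s
  proof -
    have "((\<lambda>k. off i k * ?P s k j + (if k = i then q i i * ?P s i j else 0)) has_sum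
        (N i j s + q i i * ?P s i j)) UNIV"
      by (intro has_sum_add N_has_sum has_sum_finite_neutralI[of "{i}"]) auto
    also have "(\<lambda>k. off i k * ?P s k j + (if k = i then q i i * ?P s i j else 0)) =
        (\<lambda>k. q i k * ?P s k j)"
      by (auto simp: off_def)
    finally show ?thesis .
  qed
  have deriv: "((\<lambda>s. ?P s i j) has_real_derivative (N i j t + q i i * ?P t i j)) (at t within {0..})"
    if t: "0 \<le> t" for i j t
  proof -
    let ?f = "\<lambda>s. exp (- q i i * s) * N i j s"
    let ?\<delta> = "if i = j then 1 else 0 :: real"
    let ?g = "\<lambda>t. exp (- (- q i i * t)) * (?\<delta> + integral {0..t} ?f)"
    have "((\<lambda>x. integral {0..x} ?f) has_real_derivative ?f t) (at t within {0..t+1})"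
      by (rule integral_has_real_derivative) (use t in \<open>auto intro!: continuous_intros N_cont\<close>)
    then have "(?g has_real_derivative (exp (- (- q i i * t)) * ?f t + q i i * ?g t)) (at t within {0..t+1})"
      by (auto intro!: derivative_eq_intros simp: algebra_simps)
    also have "exp (- (- q i i * t)) * ?f t + q i i * ?g t = N i j t + q i i * ?P t i j"
      using P_eq[OF t, where i=i and j=j] by (simp flip: mult.assoc exp_add)
    finally have "((\<lambda>s. ?P s i j) has_real_derivative (N i j t + q i i * ?P t i j)) (at t within {0..t+1})"
      by (rule has_field_derivative_transform_within[OF _ zero_less_one])
        (use t P_eq[where i=i and j=j] in auto)
    \<comment> \<open>Only times near \<open>t\<close> matter, and \<open>t\<close> is not the right end point of \<open>{0..t+1}\<close>.\<close>
    also have "at t within {0..t+1} = at t within {0..}"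
      by (rule at_within_nhd[of _ "{..<t+1}"]) auto
    finally show ?thesis .
  qed
  show ?thesis
    unfolding nonneg_backward_solution_def
    using P_eq[of 0] sum_eq deriv
    by (auto simp: infsumI[OF sum_eq] intro: has_sum_imp_summable[OF sum_eq])
qed

text \<open>
  Minimality gives \<open>P \<le> feller_lim q\<close>, since \<open>feller_lim q\<close> solves the backward equation, while the
  iterates lie below every nonnegative solution.
\<close>

lemma feller_minimal_eq_lim:
  assumes q: "stable_conservative_Q_matrix q" and P: "feller_minimal_transition_function q P"
  shows "at_nonneg P j i t = feller_lim q j i t"
proof (rule antisym)
  have sol: "nonneg_backward_solution q P"
    using P by (simp add: feller_minimal_transition_function_def)
  show "feller_lim q j i t \<le> at_nonneg P j i t"
    unfolding feller_lim_def by (intro SUP_least feller_iter_le_solution q sol)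
  show "at_nonneg P j i t \<le> feller_lim q j i t"
  proof (cases "0 \<le> t")
    case True
    then have "P t i j \<le> enn2real (feller_lim q j i t)"
      using P feller_lim_is_solution[OF q] by (auto simp: feller_minimal_transition_function_def)
    then show ?thesis
      using True
      by (cases "feller_lim q j i t") (auto simp: at_nonneg_def ennreal_leI)
  qed (simp add: at_nonneg_def)
qed

section \<open>The identity for the extended nonnegative reals\<close>

text \<open>
  Write \<open>x\<close> for the \<open>j\<close>-th column of \<open>Q(t)\<close>, \<open>f = jump A x\<close>, \<open>W\<close> for the potential of
  \<open>a\<^sub>k x\<^sub>k\<close> on the left and \<open>z\<close> for the right-hand side. One step of the recursion gives
  \<open>x + hold * (a x) = \<delta> hold + hold * f + hold * jump R x\<close>, and \<open>z\<close> satisfies the same equation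
  without the term in \<open>a\<close>. When \<open>R\<close> explodes, \<open>n\<close> steps of the recursion leave a remainder for \<open>x\<close>
  that is hard to control; it is absorbed by the bound \<open>x \<le> z\<close>. This bound holds because \<open>x\<close> is
  the limit of iterates that are damped at the larger rates \<open>r\<^sub>i + a\<^sub>i\<close>, and it is the start of the
  induction for \<open>x + W \<le> z\<close>. The other inequality is an induction of the same shape.
\<close>

lemma perturbation_identity:
  fixes R A Q :: "nat \<Rightarrow> nat \<Rightarrow> real"
  assumes R: "stable_conservative_Q_matrix R"
    and A: "stable_conservative_Q_matrix A"
    and Q_def: "Q = (\<lambda>i j. R i j + A i j)"
    and Q: "stable_conservative_Q_matrix Q" 
    and Qt: "feller_minimal_transition_function Q Qt"
  shows "at_nonneg Qt j i t
     + potential (feller_lim R) (\<lambda>k s. ennreal (- A k k) * at_nonneg Qt j k s) i t =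
     feller_lim R j i t + potential (feller_lim R) (jump A (at_nonneg Qt j)) i t"
proof -
  let ?x = "at_nonneg Qt j"
  let ?ax = "\<lambda>k s. ennreal (- A k k) * ?x k s"
  let ?f = "jump A ?x"
  have sol: "nonneg_backward_solution Q Qt"
    using Qt by (simp add: feller_minimal_transition_function_def)
  have [measurable]: "?x l \<in> borel_measurable borel" for l
    by (rule solution_measurable[OF sol])
  have jump_Q: "jump Q y i s = jump A y i s + jump R y i s" for y i s
  proof -
    have "ennreal (if l = i then 0 else Q i l) =
        ennreal (if l = i then 0 else A i l) + ennreal (if l = i then 0 else R i l)" for l
      using R A by (auto simp: Q_def stable_conservative_Q_matrix_def ennreal_plus add.commute)
    then show ?thesis
      unfolding jump_def by (simp add: distrib_right suminf_add)
  qed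
  define W where "W = potential (feller_lim R) ?ax"
  define z where "z i t = feller_lim R j i t + potential (feller_lim R) ?f i t" for i t
  let ?W = "\<lambda>n. potential (\<lambda>k. feller_iter R k n) ?ax"
  let ?Z = "\<lambda>n i t. feller_iter R j n i t + potential (\<lambda>k. feller_iter R k n) ?f i t"
  let ?h = "\<lambda>i. hold (- R i i)"
  let ?\<delta> = "\<lambda>i t. if i = j then ?h i t else 0"
  have x_eq: "?x i t + conv (?h i) (?ax i) t =
      ?\<delta> i t + (conv (?h i) (?f i) t + conv (?h i) (jump R ?x i) t)" for i t
  proof -
    have "conv (?h i) (jump Q ?x i) t = conv (?h i) (?f i) t + conv (?h i) (jump R ?x i) t"
      by (subst conv_add_right[symmetric]) (auto simp: jump_Q[abs_def])
    then show ?thesis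
      using solution_renewal[OF Q sol, of "- R i i" "- A i i" i j t] A
      by (simp add: Q_def stable_conservative_Q_matrix_def)
  qed
  have z_eq: "z i t = ?\<delta> i t + (conv (?h i) (?f i) t + conv (?h i) (jump R z i) t)" for i t
  proof -
    have "jump R z i = (\<lambda>s. jump R (feller_lim R j) i s + jump R (potential (feller_lim R) ?f) i s)"
      by (simp add: z_def[abs_def] jump_add fun_eq_iff)
    then show ?thesis
      unfolding z_def by (subst feller_lim_renewal, subst potential_lim_renewal)
         (auto simp: conv_add_right ac_simps)
  qed
  have Z_eq: "?Z (Suc n) i t = ?\<delta> i t + (conv (?h i) (?f i) t + conv (?h i) (jump R (?Z n) i) t)" for n i t
    by (subst potential_iter_Suc)
       (auto simp: jump_add[abs_def] conv_add_right ac_simps)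
  have z_meas [measurable]: "z i \<in> borel_measurable borel" for i
    unfolding z_def by measurable
  have iter_le_z: "feller_iter Q j n i t \<le> z i t" for n i t
  proof (induction n arbitrary: i t)
    case (Suc n)
    have hold_le: "hold (- Q k k) s \<le> ?h k s" for k s
      using A by (auto simp: hold_def Q_def stable_conservative_Q_matrix_def algebra_simps
          mult_nonneg_nonpos split: split_indicator intro!: ennreal_leI)
    have "feller_iter Q j (Suc n) i t \<le> ?\<delta> i t + conv (?h i)
        (\<lambda>s. jump A (feller_iter Q j n) i s + jump R (feller_iter Q j n) i s) t"
      unfolding feller_iter.simps jump_Q[abs_def]
      by (intro add_mono conv_mono order_refl) (auto simp: hold_le)
    also have "\<dots> \<le> ?\<delta> i t + conv (?h i) (\<lambda>s. ?f i s + jump R z i s) t"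
      by (intro add_mono conv_mono jump_mono Suc feller_iter_le_solution Q sol order_refl)
    also have "\<dots> = z i t"
      by (subst z_eq, subst conv_add_right) auto
    finally show ?case .
  qed simp
  \<comment> \<open>The minimality of \<open>Q(t)\<close> enters here.\<close>
  have x_le_z: "?x i t \<le> z i t" for i t
    unfolding feller_minimal_eq_lim[OF Q Qt] feller_lim_def by (intro SUP_least iter_le_z)
  \<comment> \<open>\<open>x\<close> satisfies its equation with a nonnegative loss term on the left, so \<open>x + W\<^sub>n\<close> reproduces the equation of \<open>z\<close>.\<close>
  have upper: "?x i t + ?W n i t \<le> z i t" for n i t
  proof (induction n arbitrary: i t)
    case 0
    then show ?case by (simp add: potential_def x_le_z)
  next
    case (Suc n)
    have "?x i t + ?W (Suc n) i t =
        (?x i t + conv (?h i) (?ax i) t) + conv (?h i) (jump R (?W n) i) t"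
      by (subst potential_iter_Suc) (auto simp: add.assoc)
    also have "\<dots> = ?\<delta> i t + (conv (?h i) (?f i) t +
        conv (?h i) (jump R (\<lambda>l s. ?x l s + ?W n l s) i) t)"
      unfolding x_eq by (simp add: jump_add[abs_def] conv_add_right add.assoc)
    also have "\<dots> \<le> ?\<delta> i t + (conv (?h i) (?f i) t + conv (?h i) (jump R z i) t)"
      by (intro add_left_mono conv_mono jump_mono Suc order_refl)
    finally show ?case by (simp only: z_eq[symmetric])
  qed
  have lower: "?Z n i t \<le> ?x i t + ?W n i t" for n i t
  proof (induction n arbitrary: i t)
    case 0
    then show ?case by (simp add: potential_def)
  next
    case (Suc n)
    have "?Z (Suc n) i t \<le> ?\<delta> i t + (conv (?h i) (?f i) t +
        conv (?h i) (jump R (\<lambda>l s. ?x l s + ?W n l s) i) t)"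
      unfolding Z_eq by (intro add_left_mono conv_mono jump_mono Suc order_refl)
    also have "\<dots> = (?x i t + conv (?h i) (?ax i) t) + conv (?h i) (jump R (?W n) i) t"
      unfolding x_eq by (simp add: jump_add[abs_def] conv_add_right add.assoc)
    also have "\<dots> = ?x i t + ?W (Suc n) i t"
      by (subst potential_iter_Suc) (auto simp: add.assoc)
    finally show ?case .
  qed
  have W_SUP: "?x i t + W i t = (SUP n. ?x i t + ?W n i t)"
    by (simp add: W_def potential_lim ennreal_SUP_add_right)
  have z_SUP: "z i t = (SUP n. ?Z n i t)"
    unfolding z_def potential_lim[of ?f, OF jump_measurable[OF \<open>\<And>l. ?x l \<in> borel_measurable borel\<close>]]
    unfolding feller_lim_def
    by (intro ennreal_SUP_add[symmetric] feller_iter_incseq potential_iter_incseq)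
  have "?x i t + W i t \<le> z i t"
    unfolding W_SUP by (intro SUP_least upper)
  moreover have "z i t \<le> ?x i t + W i t"
    unfolding W_SUP z_SUP by (intro SUP_mono lower) (auto intro: lower)
  ultimately show ?thesis
    by (simp add: W_def z_def)
qed

section \<open>Sums and integrals of signed families\<close>

lemma infsum_ennreal_eq_suminf:
  fixes f :: "nat \<Rightarrow> ennreal"
  shows "(\<Sum>\<^sub>\<infinity>k. f k) = (\<Sum>k. f k)"
  by (intro sums_unique has_sum_imp_sums has_sum_infsum nonneg_summable_on_complete) simp

lemma has_sum_ennreal_pair:
  fixes f :: "nat \<times> nat \<Rightarrow> ennreal"
  shows "(f has_sum (\<Sum>k. \<Sum>l. f (k, l))) UNIV"
proof -
  have "infsum f UNIV = (\<Sum>\<^sub>\<infinity>n. f (prod_decode n))"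
    by (rule infsum_reindex_bij_betw[OF bij_prod_decode, symmetric])
  also have "\<dots> = (\<Sum>k. \<Sum>l. f (k, l))"
    unfolding infsum_ennreal_eq_suminf by (rule suminf_ennreal_2dimen) simp
  finally show ?thesis
    using has_sum_infsum[OF nonneg_summable_on_complete[of UNIV f]] by simp
qed

lemma has_sum_real_of_ennreal:
  fixes f :: "'a \<Rightarrow> real"
  assumes "((\<lambda>x. ennreal (f x)) has_sum S) A" "S < top" and nonneg: "\<And>x. 0 \<le> f x"
  shows "(f has_sum enn2real S) A"
proof -
  have "sum (\<lambda>x. ennreal (f x)) = (\<lambda>F. ennreal (sum f F))"
    by (rule ext) (rule sum_ennreal[OF nonneg])
  then have "((\<lambda>F. ennreal (sum f F)) \<longlongrightarrow> ennreal (enn2real S)) (finite_subsets_at_top A)"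
    using assms(1,2) by (simp add: has_sum_def)
  then show ?thesis
    unfolding has_sum_def
    by (rule tendsto_ennrealD) (auto intro!: always_eventually sum_nonneg nonneg)
qed

lemma has_sum_ennreal_of_real:
  fixes f :: "'a \<Rightarrow> real"
  assumes "(f has_sum S) A" and nonneg: "\<And>x. 0 \<le> f x"
  shows "((\<lambda>x. ennreal (f x)) has_sum ennreal S) A"
proof -
  have "sum (\<lambda>x. ennreal (f x)) = (\<lambda>F. ennreal (sum f F))"
    by (rule ext) (rule sum_ennreal[OF nonneg])
  then show ?thesis
    using assms(1) by (simp add: has_sum_def tendsto_ennrealI)
qed

text \<open>
  A \<open>Q\<close>-matrix is nonpositive on the diagonal and nonnegative off it, so the double series in the
  second identity splits into a nonnegative off-diagonal part and a nonpositive diagonal part. The equivalence,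
  rather than just the implication from right to left, determines the value of \<open>infsum\<close>, and
  therefore its measurability in \<open>s\<close>, also where the series diverges.
\<close>

lemma signed_infsum:
  fixes p :: "nat \<times> nat \<Rightarrow> real"
  assumes off: "\<And>k l. k \<noteq> l \<Longrightarrow> 0 \<le> p (k, l)" and diag: "\<And>k. p (k, k) \<le> 0"
  defines "S \<equiv> (\<Sum>k. \<Sum>l. ennreal (if l = k then 0 else p (k, l)))"
    and "D \<equiv> (\<Sum>k. ennreal (- p (k, k)))"
  shows "p summable_on UNIV \<longleftrightarrow> S < top \<and> D < top"
    and "S < top \<Longrightarrow> D < top \<Longrightarrow> infsum p UNIV = enn2real S - enn2real D"
proof -
  let ?po = "\<lambda>(k, l). if l = k then 0 else p (k, l)"
  let ?pd = "\<lambda>(k, l). if l = k then - p (k, l) else 0"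
  have "(\<Sum>k. \<Sum>l. ennreal (?pd (k, l))) = (\<Sum>k. \<Sum>l. if l = k then ennreal (- p (k, k)) else 0)"
    by (intro suminf_cong) auto
  also have "\<dots> = D"
    unfolding D_def by (intro suminf_cong) (subst suminf_finite[of "{_}"]; auto)
  finally have D: "((\<lambda>x. ennreal (?pd x)) has_sum D) UNIV"
    using has_sum_ennreal_pair[of "\<lambda>x. ennreal (?pd x)"] by simp
  have S: "((\<lambda>x. ennreal (?po x)) has_sum S) UNIV"
    using has_sum_ennreal_pair[of "\<lambda>x. ennreal (?po x)"] by (simp add: S_def)
  have *: "(p has_sum (enn2real S - enn2real D)) UNIV" if "S < top" "D < top"
  proof -
    have "((\<lambda>x. ?po x + - ?pd x) has_sum (enn2real S + - enn2real D)) UNIV"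
      using that off diag
      by (intro has_sum_add has_sum_uminusI has_sum_real_of_ennreal[OF S] has_sum_real_of_ennreal[OF D]) auto
    also have "(\<lambda>x. ?po x + - ?pd x) = p" by auto
    finally show ?thesis by simp
  qed
  then show "infsum p UNIV = enn2real S - enn2real D" if "S < top" "D < top"
    using that by (auto intro: infsumI)
  have "S < top \<and> D < top" if "p summable_on UNIV"
  proof -
    have "(\<lambda>x. \<bar>p x\<bar>) summable_on UNIV"
      using that summable_on_iff_abs_summable_on_real by force
    then have abs: "((\<lambda>x. ennreal \<bar>p x\<bar>) has_sum ennreal (infsum (\<lambda>x. \<bar>p x\<bar>) UNIV)) UNIV"
      by (intro has_sum_ennreal_of_real has_sum_infsum) auto
    have "S \<le> ennreal (infsum (\<lambda>x. \<bar>p x\<bar>) UNIV)"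
      by (rule has_sum_mono[OF S abs]) (auto intro!: ennreal_leI)
    moreover have "D \<le> ennreal (infsum (\<lambda>x. \<bar>p x\<bar>) UNIV)"
      by (rule has_sum_mono[OF D abs]) (auto intro!: ennreal_leI)
    ultimately show ?thesis
      using ennreal_less_top le_less_trans by blast
  qed
  with * show "p summable_on UNIV \<longleftrightarrow> S < top \<and> D < top"
    by (auto simp: summable_on_def)
qed

lemma has_bochner_integral_enn2real:
  assumes [measurable]: "h \<in> borel_measurable M" and fin: "(\<integral>\<^sup>+x. h x \<partial>M) < top"
  shows "has_bochner_integral M (\<lambda>x. enn2real (h x)) (enn2real (\<integral>\<^sup>+x. h x \<partial>M))"
proof (rule has_bochner_integral_nn_integral)
  have "AE x in M. h x \<noteq> \<infinity>"
    by (rule nn_integral_PInf_AE) (use fin in auto)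
  then have "(\<integral>\<^sup>+x. ennreal (enn2real (h x)) \<partial>M) = (\<integral>\<^sup>+x. h x \<partial>M)"
    by (intro nn_integral_cong_AE) (auto simp: less_top)
  then show "(\<integral>\<^sup>+x. ennreal (enn2real (h x)) \<partial>M) = ennreal (enn2real (\<integral>\<^sup>+x. h x \<partial>M))"
    using fin by simp
qed auto

lemma conv_at_nonneg:
  assumes "\<And>s i j. 0 \<le> s \<Longrightarrow> 0 \<le> P s i j" "0 \<le> c"
  shows "conv (at_nonneg P k i) (\<lambda>s. ennreal c * at_nonneg P' j l s) t =
    (\<integral>\<^sup>+s\<in>{0..t}. ennreal (P s i k * c * P' (t - s) l j) \<partial>lborel)"
  unfolding conv_def
  by (intro nn_integral_cong)
     (use assms in \<open>auto simp: at_nonneg_def ennreal_mult' mult.assoc split: split_indicator\<close>)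

lemma conv_at_nonneg_swap:
  assumes "\<And>s i j. 0 \<le> s \<Longrightarrow> 0 \<le> P s i j" "0 \<le> c"
    and [measurable]: "at_nonneg P k i \<in> borel_measurable borel" "at_nonneg P' j l \<in> borel_measurable borel"
  shows "conv (at_nonneg P k i) (\<lambda>s. ennreal c * at_nonneg P' j l s) t =
    (\<integral>\<^sup>+v\<in>{0..t}. ennreal (P (t - v) i k * c * P' v l j) \<partial>lborel)"
proof -
  have "conv (at_nonneg P k i) (\<lambda>s. ennreal c * at_nonneg P' j l s) t =
      conv (\<lambda>s. ennreal c * at_nonneg P' j l s) (at_nonneg P k i) t"
    by (subst conv_commute) auto
  also have "\<dots> = (\<integral>\<^sup>+v\<in>{0..t}. ennreal (P (t - v) i k * c * P' v l j) \<partial>lborel)"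
    unfolding conv_def
    by (intro nn_integral_cong)
       (use assms in \<open>auto simp: at_nonneg_def ennreal_mult' ennreal_mult'' mult_ac split: split_indicator\<close>)
  finally show ?thesis .
qed

lemma potential_eq_nn_integral:
  assumes [measurable]: "\<And>k. F k i \<in> borel_measurable borel" "\<And>k. \<phi> k \<in> borel_measurable borel"
  shows "potential F \<phi> i t = (\<integral>\<^sup>+s. (\<Sum>k. F k i s * \<phi> k (t - s)) \<partial>lborel)"
  unfolding potential_def conv_def by (simp add: nn_integral_suminf)

section \<open>The perturbation formula\<close>

theorem theorem1p2:
  fixes R A Q :: "nat \<Rightarrow> nat \<Rightarrow> real"
    and Rt Qt :: "real \<Rightarrow> nat \<Rightarrow> nat \<Rightarrow> real"
    and i j :: nat and t :: real
  assumes "stable_conservative_Q_matrix R"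
    and "stable_conservative_Q_matrix A"
    and "Q = (\<lambda>i j. R i j + A i j)"
    and "feller_minimal_transition_function Q Qt"
    and "feller_minimal_transition_function R Rt"
    and "0 \<le> t"
  shows "enn2ereal (\<Sum>\<^sub>\<infinity>k. (\<integral>\<^sup>+s\<in>{0..t}. ennreal (Rt s i k * (- A k k) * Qt (t - s) k j) \<partial>lborel)) =
           enn2ereal (\<Sum>\<^sub>\<infinity>(l, m)\<in>{(l, m). m \<noteq> l}.
             (\<integral>\<^sup>+v\<in>{0..t}. ennreal (Rt (t - v) i l * A l m * Qt v m j) \<partial>lborel))
           + ereal (Rt t i j - Qt t i j)
       \<and> ((\<Sum>\<^sub>\<infinity>k. (\<integral>\<^sup>+s\<in>{0..t}. ennreal (Rt s i k * (- A k k) * Qt (t - s) k j) \<partial>lborel)) < \<infinity> \<longrightarrow>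
           (AE s\<in>{0..t} in lborel. (\<lambda>(k, l). Rt s i k * A k l * Qt (t - s) l j) summable_on UNIV) \<and>
           set_integrable lborel {0..t} (\<lambda>s. \<Sum>\<^sub>\<infinity>(k, l). Rt s i k * A k l * Qt (t - s) l j) \<and>
           Qt t i j - Rt t i j =
             (LINT s:{0..t}|lborel. \<Sum>\<^sub>\<infinity>(k, l). Rt s i k * A k l * Qt (t - s) l j))"
proof -
  have Q: "stable_conservative_Q_matrix Q"
    unfolding stable_conservative_Q_matrix_def
  proof (intro conjI allI impI)
    show "0 \<le> - Q k k" for k
      using assms(1,2) add_nonpos_nonpos[of "R k k" "A k k"]
      by (simp add: assms(3) stable_conservative_Q_matrix_def)
    show "(Q k has_sum 0) UNIV" for k
      using assms(1,2) has_sum_add[of "R k" UNIV 0 "A k" 0]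
      by (simp add: assms(3) stable_conservative_Q_matrix_def)
  qed (use assms(1-3) in \<open>simp add: stable_conservative_Q_matrix_def\<close>)
  note eq_lim = feller_minimal_eq_lim[OF assms(1,5)]
  have lim: "feller_lim R = at_nonneg Rt"
    by (simp add: fun_eq_iff eq_lim)
  have solR: "nonneg_backward_solution R Rt" and solQ: "nonneg_backward_solution Q Qt"
    using assms(4,5) by (simp_all add: feller_minimal_transition_function_def)
  have R_nonneg: "0 \<le> Rt s k l" and Q_nonneg: "0 \<le> Qt s k l" if "0 \<le> s" for s k l
    using solR solQ that by (auto simp: nonneg_backward_solution_def)
  have A_diag: "0 \<le> - A k k" and A_off: "k \<noteq> l \<Longrightarrow> 0 \<le> A k l" for k l
    using assms(2) by (auto simp: stable_conservative_Q_matrix_def)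
  have [measurable]: "at_nonneg Rt k l \<in> borel_measurable borel"
    "at_nonneg Qt k l \<in> borel_measurable borel" for k l
    using solution_measurable solR solQ by auto
  let ?x = "at_nonneg Qt j"
  let ?ax = "\<lambda>k s. ennreal (- A k k) * ?x k s"
  define W where "W = potential (at_nonneg Rt) ?ax i t"
  define F where "F = potential (at_nonneg Rt) (jump A ?x) i t"
  have id: "ennreal (Qt t i j) + W = ennreal (Rt t i j) + F"
    using perturbation_identity[OF assms(1-3) Q assms(4), of j i t] \<open>0 \<le> t\<close>
    by (simp add: W_def F_def lim at_nonneg_def[of _ _ _ t])
  have W_eq: "(\<Sum>\<^sub>\<infinity>k. (\<integral>\<^sup>+s\<in>{0..t}. ennreal (Rt s i k * (- A k k) * Qt (t - s) k j) \<partial>lborel)) = W"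
    unfolding W_def potential_def infsum_ennreal_eq_suminf
    by (intro suminf_cong conv_at_nonneg[symmetric] R_nonneg A_diag)
  have F_eq: "(\<Sum>\<^sub>\<infinity>(l, m)\<in>{(l, m). m \<noteq> l}.
      (\<integral>\<^sup>+v\<in>{0..t}. ennreal (Rt (t - v) i l * A l m * Qt v m j) \<partial>lborel)) = F" (is "?lhs = F")
  proof -
    let ?c = "\<lambda>l m. if m = l then 0 else A l m"
    let ?T = "\<lambda>(l, m). conv (at_nonneg Rt l i) (\<lambda>s. ennreal (?c l m) * ?x m s) t"
    have "?lhs = infsum ?T {(l, m). m \<noteq> l}"
      by (intro infsum_cong) (auto simp: conv_at_nonneg_swap R_nonneg A_off)
    also have "\<dots> = infsum ?T UNIV"
      by (rule infsum_cong_neutral) (auto simp: conv_def)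
    also have "\<dots> = (\<Sum>l. \<Sum>m. ?T (l, m))"
      by (rule infsumI[OF has_sum_ennreal_pair])
    also have "\<dots> = F"
      unfolding F_def potential_def jump_def[abs_def]
      by (simp add: conv_suminf_right)
    finally show ?thesis .
  qed
  have first: "enn2ereal W = enn2ereal F + ereal (Rt t i j - Qt t i j)"
    using id R_nonneg[OF \<open>0 \<le> t\<close>, of i j] Q_nonneg[OF \<open>0 \<le> t\<close>, of i j]
    by (cases W; cases F) (auto simp flip: ennreal_plus)
  have second: "(AE s\<in>{0..t} in lborel. (\<lambda>(k, l). Rt s i k * A k l * Qt (t - s) l j) summable_on UNIV) \<and>
      set_integrable lborel {0..t} (\<lambda>s. \<Sum>\<^sub>\<infinity>(k, l). Rt s i k * A k l * Qt (t - s) l j) \<and>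
      Qt t i j - Rt t i j =
        (LINT s:{0..t}|lborel. \<Sum>\<^sub>\<infinity>(k, l). Rt s i k * A k l * Qt (t - s) l j)"
    if W_fin: "W < \<infinity>"
  proof -
    have F_fin: "F < \<infinity>"
      using id W_fin by (cases W; cases F) (auto simp flip: ennreal_plus)
    define D where "D s = (\<Sum>k. at_nonneg Rt k i s * ?ax k (t - s))" for s
    define S where "S s = (\<Sum>k. at_nonneg Rt k i s * jump A ?x k (t - s))" for s
    have [measurable]: "D \<in> borel_measurable borel" "S \<in> borel_measurable borel"
      unfolding D_def S_def by measurable
    have W_int: "W = (\<integral>\<^sup>+s. D s \<partial>lborel)" and F_int: "F = (\<integral>\<^sup>+s. S s \<partial>lborel)"
      unfolding W_def F_def D_def S_def by (intro potential_eq_nn_integral; measurable)+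
    define p where "p s = (\<lambda>(k, l). Rt s i k * A k l * Qt (t - s) l j)" for s
    have D_eq: "D s = (\<Sum>k. ennreal (- p s (k, k)))"
      and S_eq: "S s = (\<Sum>k. \<Sum>l. ennreal (if l = k then 0 else p s (k, l)))"
      and p_off: "k \<noteq> l \<Longrightarrow> 0 \<le> p s (k, l)" and p_diag: "p s (k, k) \<le> 0"
      if s: "s \<in> {0..t}" for s k l
    proof -
      have R: "0 \<le> Rt s i k" and Q: "0 \<le> Qt (t - s) k j" for k
        using s by (auto intro: R_nonneg Q_nonneg)
      have "at_nonneg Rt k i s * ?ax k (t - s) = ennreal (Rt s i k * (- A k k * Qt (t - s) k j))" for k
        unfolding ennreal_mult'[OF R] ennreal_mult'[OF A_diag] using s by (simp add: at_nonneg_def)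
      then show "D s = (\<Sum>k. ennreal (- p s (k, k)))"
        unfolding D_def p_def by (simp add: mult.assoc)
      have "at_nonneg Rt k i s * (ennreal (if l = k then 0 else A k l) * ?x l (t - s)) =
          ennreal (if l = k then 0 else p s (k, l))" for k l
        unfolding p_def using s R A_off[of k l] by (simp add: at_nonneg_def ennreal_mult' mult.assoc)
      then show "S s = (\<Sum>k. \<Sum>l. ennreal (if l = k then 0 else p s (k, l)))"
        unfolding S_def jump_def by (simp flip: ennreal_suminf_cmult)
      show "p s (k, l) \<ge> 0" if "k \<noteq> l"
        unfolding p_def using R Q A_off[OF that] by simp
      show "p s (k, k) \<le> 0"
        unfolding p_def using R Q A_diag[of k] by (simp add: mult_nonneg_nonpos mult_nonpos_nonneg)
    qed
    have D_out: "D s = 0" and S_out: "S s = 0" if "s \<notin> {0..t}" for s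
      using that by (auto simp: D_def S_def at_nonneg_def jump_def split: split_indicator)
    have summable: "p s summable_on UNIV \<longleftrightarrow> S s < top \<and> D s < top" if "s \<in> {0..t}" for s
      unfolding D_eq[OF that] S_eq[OF that] using p_off[OF that] p_diag[OF that]
      by (rule signed_infsum(1))
    have infsum_eq: "infsum (p s) UNIV = enn2real (S s) - enn2real (D s)"
      if s: "s \<in> {0..t}" and fin: "S s < top" "D s < top" for s
      using p_off[OF s] p_diag[OF s] fin unfolding D_eq[OF s] S_eq[OF s]
      by (rule signed_infsum(2))
    have AE_fin: "AE s in lborel. S s < top \<and> D s < top"
      using nn_integral_PInf_AE[of S lborel] nn_integral_PInf_AE[of D lborel] W_fin F_fin
      by (auto simp: W_int F_int less_top)
    \<comment> \<open>Equality almost everywhere is not enough for Borel measurability, so the integrand is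
      identified at every point, with the value 0 where the series diverges.\<close>
    define G where "G s = (if S s < top \<and> D s < top then enn2real (S s) - enn2real (D s) else 0)" for s
    have G_eq: "indicator {0..t} s *\<^sub>R infsum (p s) UNIV = G s" for s
      using summable[of s] infsum_eq[of s] D_out[of s] S_out[of s] infsum_not_exists[of "p s" UNIV]
      by (cases "s \<in> {0..t}") (auto simp: G_def)
    have "has_bochner_integral lborel (\<lambda>s. enn2real (S s) - enn2real (D s)) (enn2real F - enn2real W)"
      unfolding W_int F_int using W_fin F_fin
      by (intro has_bochner_integral_diff has_bochner_integral_enn2real) (auto simp: W_int F_int)
    also have "?this \<longleftrightarrow> has_bochner_integral lborel G (enn2real F - enn2real W)"
      by (intro has_bochner_integral_cong_AE) (use AE_fin in \<open>auto simp: G_def[abs_def]\<close>)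
    finally have G: "has_bochner_integral lborel G (enn2real F - enn2real W)" .
    have "enn2real F - enn2real W = Qt t i j - Rt t i j"
      using id W_fin F_fin R_nonneg[OF \<open>0 \<le> t\<close>, of i j] Q_nonneg[OF \<open>0 \<le> t\<close>, of i j]
      by (cases W; cases F) (auto simp flip: ennreal_plus)
    moreover have "AE s\<in>{0..t} in lborel. p s summable_on UNIV"
      using AE_fin by eventually_elim (simp add: summable)
    ultimately show ?thesis
      using G unfolding p_def[symmetric] set_integrable_def set_lebesgue_integral_def G_eq has_bochner_integral_iff
      by simp
  qed
  show ?thesis
    unfolding W_eq F_eq using first second by simp
qed

end
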